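(* Let $\gamma:I\to(S^2,\langle\cdot,\cdot\rangle)$ be a smooth curve on an interval $I\subset\mathbb R$, parametrized by arc length, with geodesic curvature $\kappa$. Then $\gamma$ is a $3$-harmonic curve if and only if $$ \begin{cases} \kappa^{(4)}-12(\kappa')^2-10\kappa^2\kappa''+\kappa^5-3\kappa(\kappa')^2+\kappa''-\kappa^3=0,\\ \kappa\kappa^{(3)}-2\kappa^3\kappa'+2\kappa'\kappa''=0. \end{cases} $$
   Context: $S^2$ is the unit sphere with its standard metric $\langle\cdot,\cdot\rangle$ of constant curvature $1$, Levi-Civita connection $\nabla^N$ and curvature tensor $R(X,Y)=\nabla^N_X\nabla^N_Y-\nabla^N_Y\nabla^N_X-\nabla^N_{[X,Y]}$. The Frenet frame $(T,N)$ of $\gamma$ is orthonormal along $\gamma$ with $\gamma'=T$, $\nabla^N_{\gamma'}T=\kappa N$, $\nabla^N_{\gamma'}N=-\kappa T$; $\kappa$ is the geodesic curvature, and primes and $\kappa^{(i)}$ are derivatives with respect to arc length. For a unit-speed curve put $\tau(\gamma)=\nabla^N_{\gamma'}\gamma'$ and, for vector fields $V$ along $\gamma$, $\overline\Delta V=-\nabla^N_{\gamma'}\nabla^N_{\gamma'}V$. For $k\ge2$, $\gamma$ is $k$-harmonic if $\tau_k(\gamma):=\overline\Delta^{k-1}\tau(\gamma)-R\big(\overline\Delta^{k-2}\tau(\gamma),\gamma'\big)\gamma'=0$. *)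

theory Defs
  imports "HOL-Analysis.Analysis"
begin

abbreviation S2 :: "(real^3) set" where
  "S2 \<equiv> sphere 0 1"

text \<open>Orthogonal projection of the ambient space onto the tangent plane of \<open>S2\<close> at \<open>p \<in> S2\<close>.\<close>

definition tproj :: "real^3 \<Rightarrow> real^3 \<Rightarrow> real^3" where
  "tproj p v = v - (v \<bullet> p) *\<^sub>R p"

subsection \<open>Levi-Civita connection and curvature of the unit sphere\<close>

text \<open>Only the values of a map on \<open>S2\<close> are meaningful, so it is differentiated at \<open>p \<in> S2\<close> in
  the tangent direction \<open>h\<close> through its radially constant extension to \<open>x \<noteq> 0\<close>.\<close>

definition sphere_deriv :: "(real^3 \<Rightarrow> real^3) \<Rightarrow> real^3 \<Rightarrow> real^3 \<Rightarrow> real^3" where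
  "sphere_deriv V p h = frechet_derivative (\<lambda>x. V (x /\<^sub>R norm x)) (at p) h"

text \<open>The metric of \<open>S2\<close> is induced from the ambient space, so its Levi-Civita connection is
  the tangential part of the ambient derivative.\<close>

definition lc_conn :: "(real^3 \<Rightarrow> real^3) \<Rightarrow> (real^3 \<Rightarrow> real^3) \<Rightarrow> real^3 \<Rightarrow> real^3" where
  "lc_conn X Y p = tproj p (sphere_deriv Y p (X p))"

definition lie_bracket :: "(real^3 \<Rightarrow> real^3) \<Rightarrow> (real^3 \<Rightarrow> real^3) \<Rightarrow> real^3 \<Rightarrow> real^3" where
  "lie_bracket X Y p = sphere_deriv Y p (X p) - sphere_deriv X p (Y p)"

definition curv_fields ::
    "(real^3 \<Rightarrow> real^3) \<Rightarrow> (real^3 \<Rightarrow> real^3) \<Rightarrow> (real^3 \<Rightarrow> real^3) \<Rightarrow> real^3 \<Rightarrow> real^3" where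
  "curv_fields X Y Z p =
     lc_conn X (lc_conn Y Z) p - lc_conn Y (lc_conn X Z) p - lc_conn (lie_bracket X Y) Z p"

text \<open>\<open>curv p u v w\<close> is \<open>R(u,v)w\<close> for \<open>u\<close>, \<open>v\<close>, \<open>w\<close> tangent at \<open>p\<close>. As \<open>R\<close> is tensorial, tangent
  vectors may be extended by any smooth tangent fields; \<open>\<lambda>q. tproj q u\<close> is one with value \<open>u\<close>
  at \<open>p\<close>.\<close>

definition curv :: "real^3 \<Rightarrow> real^3 \<Rightarrow> real^3 \<Rightarrow> real^3 \<Rightarrow> real^3" where
  "curv p u v w = curv_fields (\<lambda>q. tproj q u) (\<lambda>q. tproj q v) (\<lambda>q. tproj q w) p"

subsection \<open>Smooth curves on an interval and covariant differentiation along them\<close>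

text \<open>Derivatives are taken within the interval \<open>I\<close>, hence are one-sided at those endpoints that
  belong to \<open>I\<close>.\<close>

definition nderiv :: "real set \<Rightarrow> nat \<Rightarrow> (real \<Rightarrow> 'a::real_normed_vector) \<Rightarrow> real \<Rightarrow> 'a" where
  "nderiv I n f = ((\<lambda>g t. vector_derivative g (at t within I)) ^^ n) f"

definition smooth_along :: "real set \<Rightarrow> (real \<Rightarrow> 'a::real_normed_vector) \<Rightarrow> bool" where
  "smooth_along I f \<longleftrightarrow> (\<forall>n. nderiv I n f differentiable_on I)"

abbreviation velocity :: "real set \<Rightarrow> (real \<Rightarrow> real^3) \<Rightarrow> real \<Rightarrow> real^3" where
  "velocity I \<gamma> \<equiv> nderiv I 1 \<gamma>"

definition covD :: "real set \<Rightarrow> (real \<Rightarrow> real^3) \<Rightarrow> (real \<Rightarrow> real^3) \<Rightarrow> real \<Rightarrow> real^3" where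
  "covD I \<gamma> V t = tproj (\<gamma> t) (vector_derivative V (at t within I))"

definition unit_speed_curve :: "real set \<Rightarrow> (real \<Rightarrow> real^3) \<Rightarrow> bool" where
  "unit_speed_curve I \<gamma> \<longleftrightarrow>
     smooth_along I \<gamma> \<and> \<gamma> ` I \<subseteq> S2 \<and> (\<forall>t\<in>I. norm (velocity I \<gamma> t) = 1)"

text \<open>The unit normal \<open>N\<close>, and with it the sign of \<open>\<kappa>\<close>, is determined only up to the choice of an
  orientation; both choices are admitted.\<close>

definition frenet_frame ::
    "real set \<Rightarrow> (real \<Rightarrow> real^3) \<Rightarrow> (real \<Rightarrow> real^3) \<Rightarrow> (real \<Rightarrow> real^3) \<Rightarrow> (real \<Rightarrow> real) \<Rightarrow> bool" where
  "frenet_frame I \<gamma> T N \<kappa> \<longleftrightarrow>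
     smooth_along I N \<and>
     (\<forall>t\<in>I. T t = velocity I \<gamma> t \<and>
        T t \<bullet> \<gamma> t = 0 \<and> N t \<bullet> \<gamma> t = 0 \<and>
        norm (T t) = 1 \<and> norm (N t) = 1 \<and> T t \<bullet> N t = 0 \<and>
        covD I \<gamma> T t = \<kappa> t *\<^sub>R N t \<and>
        covD I \<gamma> N t = - (\<kappa> t *\<^sub>R T t))"

subsection \<open>Polyharmonic curves\<close>

definition tension :: "real set \<Rightarrow> (real \<Rightarrow> real^3) \<Rightarrow> real \<Rightarrow> real^3" where
  "tension I \<gamma> = covD I \<gamma> (velocity I \<gamma>)"

definition rough_laplacian ::
    "real set \<Rightarrow> (real \<Rightarrow> real^3) \<Rightarrow> (real \<Rightarrow> real^3) \<Rightarrow> real \<Rightarrow> real^3" where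
  "rough_laplacian I \<gamma> V t = - covD I \<gamma> (covD I \<gamma> V) t"

definition k_tension :: "nat \<Rightarrow> real set \<Rightarrow> (real \<Rightarrow> real^3) \<Rightarrow> real \<Rightarrow> real^3" where
  "k_tension k I \<gamma> t =
     (rough_laplacian I \<gamma> ^^ (k - 1)) (tension I \<gamma>) t
     - curv (\<gamma> t) ((rough_laplacian I \<gamma> ^^ (k - 2)) (tension I \<gamma>) t)
         (velocity I \<gamma> t) (velocity I \<gamma> t)"

text \<open>Meant for \<open>k \<ge> 2\<close> and unit-speed \<open>\<gamma>\<close> only.\<close>

definition k_harmonic :: "nat \<Rightarrow> real set \<Rightarrow> (real \<Rightarrow> real^3) \<Rightarrow> bool" where
  "k_harmonic k I \<gamma> \<longleftrightarrow> (\<forall>t\<in>I. k_tension k I \<gamma> t = 0)"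

end

theory Submission
  imports Defs
begin

text \<open>In the Frenet frame the normal component of \<open>\<tau>\<^sub>3(\<gamma>)\<close> is
  \<open>\<kappa>'''' - 15 \<kappa> \<kappa>'\<^sup>2 - 10 \<kappa>\<^sup>2 \<kappa>'' + \<kappa>\<^sup>5 + \<kappa>'' - \<kappa>\<^sup>3\<close>, which differs from the first expression of the
  theorem by \<open>12 (\<kappa> - 1) \<kappa>'\<^sup>2\<close>, and the tangential one is \<open>-5\<close> times the second expression.
  The equivalence holds nevertheless, because each of the two systems forces \<open>\<kappa>' = 0\<close>.
  Indeed the second equation says that \<open>\<kappa>\<^sup>2 \<kappa>'' - 2/5 \<kappa>\<^sup>5\<close> is a constant \<open>c\<close>, so that
  \<open>\<kappa>'\<^sup>2 = \<kappa>\<^sup>4/5 - 2 c/\<kappa> + d\<close> where \<open>\<kappa> \<noteq> 0\<close>; inserting this in the first equation gives a nonzero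
  polynomial of degree 10 that vanishes at all values of \<open>\<kappa>\<close>.\<close>

section \<open>Derivatives within an interval\<close>

text \<open>A connected set that is not a singleton has no isolated point. This makes derivatives
  within \<open>I\<close> unique, also at its endpoints.\<close>

lemma at_within_interval_neq_bot:
  fixes I :: "real set"
  assumes "is_interval I" "interior I \<noteq> {}" "t \<in> I"
  shows "at t within I \<noteq> bot"
proof -
  have "\<not> (\<exists>a. I = {a})" using assms(2) by auto
  then show ?thesis
    using connected_imp_perfect[of I t] assms is_interval_connected_1
    by (auto simp: trivial_limit_within)
qed

text \<open>\<open>vector_derivative\<close> chooses a vector satisfying
  \<open>has_vector_derivative\<close>, a predicate that sees only the values on \<open>I\<close>;
  so the equality holds even where no derivative exists.\<close>

lemma vector_derivative_within_cong:
  assumes "\<And>s. s \<in> I \<Longrightarrow> f s = g s" "t \<in> I"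
  shows "vector_derivative f (at t within I) = vector_derivative g (at t within I)"
proof -
  have "(f has_vector_derivative y) (at t within I) \<longleftrightarrow> (g has_vector_derivative y) (at t within I)" for y
    using assms has_vector_derivative_transform[of t I f g y] has_vector_derivative_transform[of t I g f y]
    by auto
  then show ?thesis by (simp add: vector_derivative_def)
qed

lemma has_real_derivative_within_unique:
  assumes "at t within I \<noteq> bot" "(f has_real_derivative D) (at t within I)"
    "(f has_real_derivative E) (at t within I)"
  shows "D = E"
  using assms vector_derivative_unique_within
  by (simp add: has_real_derivative_iff_has_vector_derivative) blast

lemma nderiv_0 [simp]: "nderiv I 0 f = f"
  by (simp add: nderiv_def)

lemma nderiv_Suc: "nderiv I (Suc n) f t = vector_derivative (nderiv I n f) (at t within I)"
  by (simp add: nderiv_def)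

lemma nderiv_nderiv: "nderiv I m (nderiv I n f) = nderiv I (m + n) f"
  by (simp add: nderiv_def funpow_add)

lemma nderiv_cong:
  assumes "\<And>s. s \<in> I \<Longrightarrow> f s = g s" "t \<in> I"
  shows "nderiv I n f t = nderiv I n g t"
  using assms(2)
proof (induction n arbitrary: t)
  case (Suc n)
  then show ?case
    unfolding nderiv_Suc by (intro vector_derivative_within_cong) auto
qed (use assms in simp)

lemma differentiable_on_cong:
  assumes "\<And>x. x \<in> S \<Longrightarrow> f x = g x"
  shows "f differentiable_on S \<longleftrightarrow> g differentiable_on S"
  using assms differentiable_transform_within[of f _ S 1 g] differentiable_transform_within[of g _ S 1 f]
  unfolding differentiable_on_def by auto

section \<open>Smooth maps along an interval\<close>

lemma smooth_along_nderiv: "smooth_along I f \<Longrightarrow> smooth_along I (nderiv I m f)"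
  by (simp add: smooth_along_def nderiv_nderiv)

lemma smooth_along_cong:
  assumes "\<And>s. s \<in> I \<Longrightarrow> f s = g s" "smooth_along I g"
  shows "smooth_along I f"
  unfolding smooth_along_def
proof
  fix n
  show "nderiv I n f differentiable_on I"
    using assms differentiable_on_cong[of I "nderiv I n f" "nderiv I n g"] nderiv_cong[of I f g]
    by (auto simp: smooth_along_def)
qed

lemma nderiv_has_vector_derivative:
  assumes "nderiv I n f differentiable_on I" "t \<in> I"
  shows "(nderiv I n f has_vector_derivative nderiv I (Suc n) f t) (at t within I)"
  using assms unfolding nderiv_Suc differentiable_on_def
  by (metis vector_derivative_works)

lemma smooth_along_has_vector_derivative:
  assumes "smooth_along I f" "t \<in> I"
  shows "(nderiv I n f has_vector_derivative nderiv I (Suc n) f t) (at t within I)"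
  using assms by (intro nderiv_has_vector_derivative) (auto simp: smooth_along_def)

text \<open>Differentiability is demanded for orders below \<open>n\<close> only, because no more is
  known when this is applied inside the induction of \<open>smooth_along_inner\<close>.\<close>

lemma nderiv_add:
  assumes I: "\<And>t. t \<in> I \<Longrightarrow> at t within I \<noteq> bot"
    and "\<And>m. m < n \<Longrightarrow> nderiv I m f differentiable_on I"
    and "\<And>m. m < n \<Longrightarrow> nderiv I m g differentiable_on I"
    and "t \<in> I"
  shows "nderiv I n (\<lambda>s. f s + g s) t = nderiv I n f t + nderiv I n g t"
  using assms(2-)
proof (induction n arbitrary: t)
  case (Suc n)
  have "nderiv I (Suc n) (\<lambda>s. f s + g s) t
      = vector_derivative (\<lambda>s. nderiv I n f s + nderiv I n g s) (at t within I)"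
    unfolding nderiv_Suc by (intro vector_derivative_within_cong Suc) auto
  also have "\<dots> = nderiv I (Suc n) f t + nderiv I (Suc n) g t"
    using Suc.prems I
    by (intro vector_derivative_within has_vector_derivative_add nderiv_has_vector_derivative) auto
  finally show ?case .
qed simp

text \<open>Strong induction on the order: the first derivative is a sum of two inner products of
  smooth maps, so the induction hypothesis has to range over all pairs of smooth maps.\<close>

lemma smooth_along_inner:
  fixes f g :: "real \<Rightarrow> 'a::real_inner"
  assumes I: "\<And>t. t \<in> I \<Longrightarrow> at t within I \<noteq> bot"
    and "smooth_along I f" "smooth_along I g"
  shows "smooth_along I (\<lambda>t. f t \<bullet> g t)"
proof -
  have "nderiv I n (\<lambda>t. f t \<bullet> g t) differentiable_on I"
    if "smooth_along I f" "smooth_along I g" for n and f g :: "real \<Rightarrow> 'a"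
    using that
  proof (induction n arbitrary: f g rule: less_induct)
    case (less n)
    note D = smooth_along_has_vector_derivative[OF less.prems(1), of _ 0, simplified]
      smooth_along_has_vector_derivative[OF less.prems(2), of _ 0, simplified]
    have prod: "((\<lambda>s. f s \<bullet> g s) has_vector_derivative
        f t \<bullet> nderiv I 1 g t + nderiv I 1 f t \<bullet> g t) (at t within I)" if "t \<in> I" for t
      using bounded_bilinear.has_vector_derivative[OF bounded_bilinear_inner D(1)[OF that] D(2)[OF that]]
      by simp
    show ?case
    proof (cases n)
      case 0
      then show ?thesis
        using prod by (auto simp: differentiable_on_def intro: differentiableI_vector)
    next
      case (Suc m)
      let ?u = "\<lambda>t. f t \<bullet> nderiv I 1 g t" and ?v = "\<lambda>t. nderiv I 1 f t \<bullet> g t"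
      have uv: "nderiv I k ?u differentiable_on I" "nderiv I k ?v differentiable_on I" if "k < n" for k
        using less.IH[OF that] less.prems smooth_along_nderiv by blast+
      have "nderiv I n (\<lambda>t. f t \<bullet> g t) t = nderiv I m ?u t + nderiv I m ?v t" if "t \<in> I" for t
      proof -
        have "nderiv I n (\<lambda>t. f t \<bullet> g t) t = nderiv I m (nderiv I 1 (\<lambda>t. f t \<bullet> g t)) t"
          by (simp add: nderiv_nderiv Suc)
        also have "\<dots> = nderiv I m (\<lambda>t. ?u t + ?v t) t"
          using that prod I
          by (intro nderiv_cong) (auto simp: nderiv_Suc intro!: vector_derivative_within)
        also have "\<dots> = nderiv I m ?u t + nderiv I m ?v t"
          using that I uv Suc by (intro nderiv_add) auto
        finally show ?thesis .
      qed
      moreover have "(\<lambda>t. nderiv I m ?u t + nderiv I m ?v t) differentiable_on I"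
        using uv[of m] Suc by (intro differentiable_on_add) auto
      ultimately show ?thesis
        by (rule iffD2[OF differentiable_on_cong])
    qed
  qed
  then show ?thesis using assms by (auto simp: smooth_along_def)
qed

section \<open>Curvature of the sphere\<close>

lemma tproj_simps:
  "tproj p (u + v) = tproj p u + tproj p v"
  "tproj p (u - v) = tproj p u - tproj p v"
  "tproj p (- v) = - tproj p v"
  "tproj p (c *\<^sub>R v) = c *\<^sub>R tproj p v"
  by (simp_all add: tproj_def algebra_simps inner_simps)

lemma tproj_self: "norm p = 1 \<Longrightarrow> tproj p p = 0"
  by (simp add: tproj_def norm_eq_1)

lemma tproj_tangent: "v \<bullet> p = 0 \<Longrightarrow> tproj p v = v"
  by (simp add: tproj_def)

lemma tproj_inner: "norm p = 1 \<Longrightarrow> tproj p v \<bullet> p = 0"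
  by (simp add: tproj_def norm_eq_1 inner_simps)

text \<open>\<open>F\<close> is a closed formula for the radially constant extension of
  \<open>V\<close>. Derivatives are local, and \<open>- {0}\<close> is an open neighbourhood of
  \<open>p\<close>.\<close>

lemma sphere_deriv_eqI:
  assumes "norm p = 1" "(F has_derivative F') (at p)"
    and "\<And>x. x \<noteq> 0 \<Longrightarrow> V (x /\<^sub>R norm x) = F x"
  shows "sphere_deriv V p h = F' h"
proof -
  have "((\<lambda>x. V (x /\<^sub>R norm x)) has_derivative F') (at p)"
    using assms by (intro has_derivative_transform_within_open[OF assms(2), of "- {0}"]) auto
  then show ?thesis
    by (simp only: sphere_deriv_def frechet_derivative_at[symmetric])
qed

lemma sphere_deriv_tproj:
  assumes "norm q = 1"
  shows "sphere_deriv (\<lambda>q. tproj q w) q h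
    = - (w \<bullet> h) *\<^sub>R q - (w \<bullet> q) *\<^sub>R h + (2 * (w \<bullet> q) * (q \<bullet> h)) *\<^sub>R q"
proof (rule sphere_deriv_eqI[OF assms])
  show "((\<lambda>x. w - ((w \<bullet> x) / (x \<bullet> x)) *\<^sub>R x) has_derivative
     (\<lambda>h. - (w \<bullet> h) *\<^sub>R q - (w \<bullet> q) *\<^sub>R h + (2 * (w \<bullet> q) * (q \<bullet> h)) *\<^sub>R q)) (at q)"
    using assms
    by (auto intro!: derivative_eq_intros
        simp: norm_eq_1 fun_eq_iff algebra_simps inner_commute)
next
  fix x :: "real^3" assume "x \<noteq> 0"
  then show "tproj (x /\<^sub>R norm x) w = w - ((w \<bullet> x) / (x \<bullet> x)) *\<^sub>R x"
    by (simp add: tproj_def dot_square_norm power2_eq_square field_simps)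
qed

text \<open>The field \<open>\<lambda>q. tproj q w\<close> is the gradient of the height function
  \<open>\<lambda>q. w \<bullet> q\<close> on the sphere, whose Hessian is minus that function times
  the metric.\<close>

lemma lc_conn_tproj:
  assumes "norm q = 1"
  shows "lc_conn X (\<lambda>q. tproj q w) q = - (w \<bullet> q) *\<^sub>R tproj q (X q)"
  using assms by (simp add: lc_conn_def sphere_deriv_tproj tproj_simps tproj_self)

text \<open>By \<open>lc_conn_tproj\<close> the inner field is
  \<open>- (w \<bullet> q) *\<^sub>R tproj q v\<close>. Its scalar factor vanishes at
  \<open>p\<close>, so the product rule leaves only the derivative of that factor.\<close>

lemma lc_conn_lc_conn_tproj:
  assumes "norm p = 1" "u \<bullet> p = 0" "v \<bullet> p = 0" "w \<bullet> p = 0"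
  shows "lc_conn (\<lambda>q. tproj q u) (lc_conn (\<lambda>q. tproj q v) (\<lambda>q. tproj q w)) p = - (w \<bullet> u) *\<^sub>R v"
proof -
  have "sphere_deriv (lc_conn (\<lambda>q. tproj q v) (\<lambda>q. tproj q w)) p h = - (w \<bullet> h) *\<^sub>R v" for h
  proof (rule sphere_deriv_eqI[OF assms(1)])
    \<comment> \<open>The radially constant extension of \<open>w \<bullet> q\<close> divides by the
      norm of \<open>x\<close>, hence the square root.\<close>
    show "((\<lambda>x. - ((w \<bullet> x) / sqrt (x \<bullet> x)) *\<^sub>R (v - ((v \<bullet> x) / (x \<bullet> x)) *\<^sub>R x)) has_derivative
        (\<lambda>h. - (w \<bullet> h) *\<^sub>R v)) (at p)"
      using assms
      by (auto intro!: derivative_eq_intros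
          simp: norm_eq_1 fun_eq_iff algebra_simps)
  next
    fix x :: "real^3" assume "x \<noteq> 0"
    then have "norm (x /\<^sub>R norm x) = 1" by simp
    then show "lc_conn (\<lambda>q. tproj q v) (\<lambda>q. tproj q w) (x /\<^sub>R norm x)
        = - ((w \<bullet> x) / sqrt (x \<bullet> x)) *\<^sub>R (v - ((v \<bullet> x) / (x \<bullet> x)) *\<^sub>R x)"
      using \<open>x \<noteq> 0\<close> unfolding lc_conn_tproj[OF \<open>norm (x /\<^sub>R norm x) = 1\<close>]
        tproj_tangent[OF tproj_inner[OF \<open>norm (x /\<^sub>R norm x) = 1\<close>]]
      by (simp add: tproj_def norm_eq_sqrt_inner power2_eq_square field_simps)
  qed
  then show ?thesis
    using assms by (simp add: lc_conn_def tproj_simps tproj_tangent)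
qed

text \<open>This is the curvature tensor of constant curvature 1. The bracket term drops out because
  \<open>lc_conn_tproj\<close> gives it the factor \<open>w \<bullet> p\<close>, which is 0.\<close>

lemma curv_tangent:
  assumes "norm p = 1" "u \<bullet> p = 0" "v \<bullet> p = 0" "w \<bullet> p = 0"
  shows "curv p u v w = (v \<bullet> w) *\<^sub>R u - (u \<bullet> w) *\<^sub>R v"
  using assms
  by (simp add: curv_def curv_fields_def lc_conn_lc_conn_tproj lc_conn_tproj inner_commute)

section \<open>Both systems force constant curvature\<close>

text \<open>\<open>x\<close>, \<open>x1\<close>, ..., \<open>x4\<close> stand for \<kappa> and its
  derivatives at one point, and the hypothesis on \<open>x4\<close> is the differentiated tangential
  equation. The pair (\<alpha>, \<beta>) is (0, 15) for the 3-tension and (12, 3) for the stated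
  system.\<close>

lemma constant_curvature_polynomial:
  fixes x x1 x2 x3 x4 \<alpha> \<beta> c d :: real
  assumes x: "x \<noteq> 0"
    and x2: "x2 = (2/5 * x^5 + c) / x^2"
    and x1: "x1^2 = (x^5/5 + d * x - 2 * c) / x"
    and x3: "x * x3 - 2 * x^3 * x1 + 2 * x1 * x2 = 0"
    and x4: "x * x4 + 3 * x1 * x3 - 6 * x^2 * x1^2 - 2 * x^3 * x2 + 2 * x2^2 = 0"
    and eq: "x4 - (\<alpha> + \<beta> * x) * x1^2 - 10 * x^2 * x2 + x^5 + x2 - x^3 = 0"
  shows "poly [: -14*c^2, 6*c*d, 0, c, 2*\<alpha>*c, -66/5*c - \<alpha>*d + 2*\<beta>*c, (12/5 - \<beta>)*d, 0,
    -3/5, -\<alpha>/5, -51/25 - \<beta>/5 :] x = 0"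
proof -
  define A where "A = 2/5 * x^5 + c"
  define B where "B = x^5/5 + d * x - 2 * c"
  have A: "x^2 * x2 = A" and B: "x * x1^2 = B"
    using x x1 x2 by (auto simp: A_def B_def)
  have "x^4 * (x1 * x3) = x1 * x^3 * (x * x3)" by algebra
  also have "\<dots> = x1 * x^3 * (2 * x^3 * x1 - 2 * x1 * x2)" using x3 by algebra
  also have "\<dots> = B * (2 * x^5 - 2 * A)" unfolding A[symmetric] B[symmetric] by algebra
  finally have C: "x^4 * (x1 * x3) = B * (2 * x^5 - 2 * A)" .
  have "x^4 * (x * x4) = - 3 * (x^4 * (x1 * x3)) + 6 * x^5 * (x * x1^2) + 2 * x^5 * (x^2 * x2)
      - 2 * (x^2 * x2)^2" using x4 by algebra
  then have D: "x^4 * (x * x4) = - 3 * (B * (2 * x^5 - 2 * A)) + 6 * x^5 * B + 2 * x^5 * A - 2 * A^2"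
    by (simp only: A B C)
  \<comment> \<open>This is \<open>eq\<close> times \<open>x^5\<close>, the power that lets every
    term be written through \<open>x\<close>, \<open>A\<close> and \<open>B\<close>, all polynomials
    in \<open>x\<close>.\<close>
  have "x^4 * (x * x4) - (\<alpha> + \<beta> * x) * x^4 * (x * x1^2) - 10 * x^5 * (x^2 * x2) + x^10
      + x^3 * (x^2 * x2) - x^8 = 0" using eq by algebra
  then have "- 3 * (B * (2 * x^5 - 2 * A)) + 6 * x^5 * B + 2 * x^5 * A - 2 * A^2
      - (\<alpha> + \<beta> * x) * x^4 * B - 10 * x^5 * A + x^10 + x^3 * A - x^8 = 0"
    by (simp only: A B D)
  then show ?thesis
    unfolding A_def B_def by (simp add: field_simps power2_eq_square numeral_eq_Suc)
qed

text \<open>Near a point where \<open>k\<close> and \<open>k1\<close> are nonzero, all values of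
  \<open>k\<close> are roots of one polynomial. The condition on \<beta> says that its coefficient
  of degree 10 is nonzero, so \<open>k\<close> takes finitely many values there and is locally
  constant, a contradiction.\<close>

lemma curvature_system_imp_constant:
  fixes k k1 k2 k3 k4 :: "real \<Rightarrow> real"
  assumes I: "is_interval I" "\<And>t. t \<in> I \<Longrightarrow> at t within I \<noteq> bot"
    and d0: "\<And>t. t \<in> I \<Longrightarrow> (k has_real_derivative k1 t) (at t within I)"
    and d1: "\<And>t. t \<in> I \<Longrightarrow> (k1 has_real_derivative k2 t) (at t within I)"
    and d2: "\<And>t. t \<in> I \<Longrightarrow> (k2 has_real_derivative k3 t) (at t within I)"
    and d3: "\<And>t. t \<in> I \<Longrightarrow> (k3 has_real_derivative k4 t) (at t within I)"
    and normal: "\<And>t. t \<in> I \<Longrightarrow>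
      k4 t - (\<alpha> + \<beta> * k t) * (k1 t)^2 - 10 * (k t)^2 * k2 t + (k t)^5 + k2 t - (k t)^3 = 0"
    and tangential: "\<And>t. t \<in> I \<Longrightarrow> k t * k3 t - 2 * (k t)^3 * k1 t + 2 * k1 t * k2 t = 0"
    and \<beta>: "\<beta> \<noteq> - 51/5"
    and t: "t \<in> I"
  shows "k1 t = 0"
proof (rule ccontr)
  assume nz: "k1 t \<noteq> 0"
  have cvx: "convex I" using I(1) by (simp add: is_interval_convex_1)
  \<comment> \<open>Differentiate the tangential equation, whose left side vanishes on all of
    \<open>I\<close>.\<close>
  have x4: "k t * k4 t + 3 * k1 t * k3 t - 6 * (k t)^2 * (k1 t)^2 - 2 * (k t)^3 * k2 t + 2 * (k2 t)^2 = 0"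
    if "t \<in> I" for t
  proof -
    have "((\<lambda>t. k t * k3 t - 2 * (k t)^3 * k1 t + 2 * k1 t * k2 t) has_real_derivative
      k t * k4 t + 3 * k1 t * k3 t - 6 * (k t)^2 * (k1 t)^2 - 2 * (k t)^3 * k2 t + 2 * (k2 t)^2)
      (at t within I)"
      by (auto intro!: derivative_eq_intros d0 d1 d2 d3 that simp: algebra_simps power2_eq_square)
    moreover have "((\<lambda>t. k t * k3 t - 2 * (k t)^3 * k1 t + 2 * k1 t * k2 t) has_real_derivative 0)
      (at t within I)"
      by (rule has_field_derivative_transform_within[where f = "\<lambda>_. 0" and d = 1]) (auto simp: tangential that)
    ultimately show ?thesis
      using has_real_derivative_within_unique[OF I(2)[OF that]] by blast
  qed
  \<comment> \<open>The factor \<open>k\<close> turns the tangential expression into an exact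
    derivative.\<close>
  have "((\<lambda>t. (k t)^2 * k2 t - 2/5 * (k t)^5) has_real_derivative 0) (at s within I)" if "s \<in> I" for s
  proof -
    have "((\<lambda>t. (k t)^2 * k2 t - 2/5 * (k t)^5) has_real_derivative
        k s * (k s * k3 s - 2 * (k s)^3 * k1 s + 2 * k1 s * k2 s)) (at s within I)"
      by (auto intro!: derivative_eq_intros d0 d2 that simp: algebra_simps power2_eq_square numeral_eq_Suc)
    then show ?thesis by (simp add: tangential that)
  qed
  then have "\<exists>c. \<forall>t\<in>I. (k t)^2 * k2 t - 2/5 * (k t)^5 = c"
    by (intro has_field_derivative_zero_constant[OF cvx])
  then obtain c where c: "\<And>t. t \<in> I \<Longrightarrow> (k t)^2 * k2 t - 2/5 * (k t)^5 = c" by blast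
  have cont: "continuous_on I k" "continuous_on I k1"
    using d0 d1 by (blast intro: DERIV_continuous_on)+
  \<comment> \<open>The next first integral divides by \<open>k\<close>. If \<open>k\<close>
    vanished wherever \<open>k1\<close> does not, it would vanish near \<open>t\<close> by
    continuity of \<open>k1\<close>, which forces \<open>k1 t = 0\<close>.\<close>
  have "\<exists>s\<in>I. k s \<noteq> 0 \<and> k1 s \<noteq> 0"
  proof (rule ccontr)
    assume no: "\<not> ?thesis"
    have "eventually (\<lambda>s. k1 s \<noteq> 0) (at t within I)"
      using cont(2) t nz by (auto simp: continuous_on_def intro: tendsto_imp_eventually_ne)
    then have "eventually (\<lambda>s. k s = 0) (at t within I)"
      using no by (auto simp: eventually_at_filter elim!: eventually_mono)
    moreover have "k t = 0" using no t nz by blast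
    ultimately have "((\<lambda>s. (k s - k t) / (s - t)) \<longlongrightarrow> 0) (at t within I)"
      by (intro tendsto_eventually) (auto elim: eventually_mono)
    then have "(k has_real_derivative 0) (at t within I)"
      by (simp add: has_field_derivative_iff)
    then show False
      using has_real_derivative_within_unique[OF I(2)[OF t] d0[OF t]] nz by blast
  qed
  then obtain s where s: "s \<in> I" "k s \<noteq> 0" "k1 s \<noteq> 0" by blast
  have "eventually (\<lambda>r. k r \<noteq> 0 \<and> k1 r \<noteq> 0) (at s within I)"
    using cont s by (auto simp: continuous_on_def intro!: eventually_conj tendsto_imp_eventually_ne)
  then obtain e where e: "e > 0" "\<And>r. r \<in> I \<Longrightarrow> dist r s < e \<Longrightarrow> k r \<noteq> 0 \<and> k1 r \<noteq> 0"
    using s unfolding eventually_at by (metis)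
  define J where "J = I \<inter> ball s e"
  have J: "J \<subseteq> I" "convex J" "s \<in> J" "\<And>r. r \<in> J \<Longrightarrow> k r \<noteq> 0 \<and> k1 r \<noteq> 0"
    using cvx s e by (auto simp: J_def dist_commute intro: convex_Int)
  \<comment> \<open>Solving the first integral for \<open>k2\<close> gives
    \<open>c / k^2 + 2/5 * k^3\<close>; multiplying by \<open>2 * k1\<close> and integrating yields
    this expression.\<close>
  have "((\<lambda>t. (k1 t)^2 - (k t)^4/5 + 2 * c / k t) has_real_derivative 0) (at r within J)" if "r \<in> J" for r
  proof -
    have rI: "r \<in> I" and nz: "k r \<noteq> 0" using J that by auto
    have "((\<lambda>t. (k1 t)^2 - (k t)^4/5 + 2 * c / k t) has_real_derivative
        2 * k1 r * k2 r - 4/5 * (k r)^3 * k1 r - 2 * c * k1 r / (k r)^2) (at r within I)"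
      using nz by (auto intro!: derivative_eq_intros d0 d1 rI simp: power2_eq_square field_simps)
    moreover have "2 * k1 r * k2 r - 4/5 * (k r)^3 * k1 r - 2 * c * k1 r / (k r)^2 = 0"
      using nz unfolding c[OF rI, symmetric] by (simp add: field_simps numeral_eq_Suc)
    ultimately show ?thesis
      using has_field_derivative_subset[OF _ J(1)] by simp
  qed
  then have "\<exists>d. \<forall>t\<in>J. (k1 t)^2 - (k t)^4/5 + 2 * c / k t = d"
    by (intro has_field_derivative_zero_constant[OF J(2)])
  then obtain d where d: "\<And>t. t \<in> J \<Longrightarrow> (k1 t)^2 - (k t)^4/5 + 2 * c / k t = d" by blast
  let ?P = "[: -14*c^2, 6*c*d, 0, c, 2*\<alpha>*c, -66/5*c - \<alpha>*d + 2*\<beta>*c, (12/5 - \<beta>)*d, 0,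
    -3/5, -\<alpha>/5, -51/25 - \<beta>/5 :]"
  have "poly ?P (k r) = 0" if "r \<in> J" for r
  proof -
    have rI: "r \<in> I" and nz: "k r \<noteq> 0" using J that by auto
    show ?thesis
    proof (rule constant_curvature_polynomial[OF nz _ _ tangential[OF rI] x4[OF rI] normal[OF rI]])
      show "k2 r = (2/5 * (k r)^5 + c) / (k r)^2"
        using c[OF rI] nz by (auto simp: field_simps)
      show "(k1 r)^2 = ((k r)^5/5 + d * k r - 2 * c) / k r"
        unfolding d[OF that, symmetric] using nz by (simp add: field_simps numeral_eq_Suc)
    qed
  qed
  then have "k ` J \<subseteq> {x. poly ?P x = 0}" by auto
  moreover have "finite {x. poly ?P x = 0}"
    using \<beta> by (intro poly_roots_finite) auto
  ultimately have fin: "finite (k ` J)" by (rule finite_subset)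
  \<comment> \<open>A finite connected subset of the line has at most one point, so \<open>k\<close>
    is constant on \<open>J\<close>.\<close>
  have "connected (k ` J)"
    using J(1,2) cont(1) by (meson connected_continuous_image continuous_on_subset convex_connected)
  then obtain a where "k ` J = {a}"
    using fin J(3) connected_finite_iff_sing[of "k ` J"] by auto
  then have "\<And>r. r \<in> J \<Longrightarrow> k r = k s" using J(3) by (metis imageI singletonD)
  then have "eventually (\<lambda>r. k r = k s) (at s within I)"
    using e(1) unfolding eventually_at by (intro exI[of _ e]) (auto simp: J_def dist_commute)
  then have "((\<lambda>r. (k r - k s) / (r - s)) \<longlongrightarrow> 0) (at s within I)"
    by (intro tendsto_eventually) (auto elim: eventually_mono)
  then have "(k has_real_derivative 0) (at s within I)"
    by (simp add: has_field_derivative_iff)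
  then show False
    using has_real_derivative_within_unique[OF I(2)[OF s(1)] d0[OF s(1)]] s(3) by blast
qed

section \<open>The 3-tension in the Frenet frame\<close>

lemma covD_cong:
  assumes "\<And>s. s \<in> I \<Longrightarrow> V s = W s" "t \<in> I"
  shows "covD I \<gamma> V t = covD I \<gamma> W t"
  unfolding covD_def using vector_derivative_within_cong[OF assms] by simp

text \<open>Leibniz rule combined with the Frenet equations. Projection fixes \<open>T t\<close> and
  \<open>N t\<close>, which are tangent, and turns the derivatives of \<open>T\<close> and
  \<open>N\<close> into covariant ones.\<close>

lemma covD_frenet:
  assumes I: "\<And>t. t \<in> I \<Longrightarrow> at t within I \<noteq> bot"
    and "smooth_along I \<gamma>" and F: "frenet_frame I \<gamma> T N \<kappa>"
    and V: "\<And>s. s \<in> I \<Longrightarrow> V s = a s *\<^sub>R T s + b s *\<^sub>R N s"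
    and a: "(a has_real_derivative a') (at t within I)"
    and b: "(b has_real_derivative b') (at t within I)"
    and t: "t \<in> I"
  shows "covD I \<gamma> V t = (a' - b t * \<kappa> t) *\<^sub>R T t + (b' + a t * \<kappa> t) *\<^sub>R N t"
proof -
  have smN: "smooth_along I N"
    and vT: "\<And>s. s \<in> I \<Longrightarrow> T s = velocity I \<gamma> s"
    and orth: "T t \<bullet> \<gamma> t = 0" "N t \<bullet> \<gamma> t = 0"
    and cov: "covD I \<gamma> T t = \<kappa> t *\<^sub>R N t" "covD I \<gamma> N t = - (\<kappa> t *\<^sub>R T t)"
    using F t by (auto simp: frenet_frame_def)
  let ?T' = "vector_derivative T (at t within I)" and ?N' = "vector_derivative N (at t within I)"
  have "T differentiable at t within I"
  proof -
    have "T differentiable_on I"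
      using assms(2) vT differentiable_on_cong[of I T "nderiv I 1 \<gamma>"]
      by (auto simp: smooth_along_def)
    then show ?thesis using t by (simp add: differentiable_on_def)
  qed
  then have T': "(T has_vector_derivative ?T') (at t within I)"
    by (simp add: vector_derivative_works)
  have "N differentiable_on I" using smN unfolding smooth_along_def by (metis nderiv_0)
  then have N': "(N has_vector_derivative ?N') (at t within I)"
    using t by (simp add: differentiable_on_def vector_derivative_works)
  have "((\<lambda>s. a s *\<^sub>R T s + b s *\<^sub>R N s) has_vector_derivative
      (a t *\<^sub>R ?T' + a' *\<^sub>R T t) + (b t *\<^sub>R ?N' + b' *\<^sub>R N t)) (at t within I)"
    by (intro has_vector_derivative_add has_vector_derivative_scaleR a b T' N')
  then have "vector_derivative (\<lambda>s. a s *\<^sub>R T s + b s *\<^sub>R N s) (at t within I)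
      = (a t *\<^sub>R ?T' + a' *\<^sub>R T t) + (b t *\<^sub>R ?N' + b' *\<^sub>R N t)"
    by (rule vector_derivative_within[OF I[OF t]])
  then have "vector_derivative V (at t within I)
      = (a t *\<^sub>R ?T' + a' *\<^sub>R T t) + (b t *\<^sub>R ?N' + b' *\<^sub>R N t)"
    by (simp only: vector_derivative_within_cong[OF V t])
  then have "covD I \<gamma> V t
      = a t *\<^sub>R covD I \<gamma> T t + a' *\<^sub>R T t + b t *\<^sub>R covD I \<gamma> N t + b' *\<^sub>R N t"
    unfolding covD_def by (simp add: tproj_simps tproj_tangent orth algebra_simps)
  then show ?thesis
    by (simp add: cov algebra_simps)
qed

text \<open>Smoothness of \<kappa> is not part of \<open>frenet_frame\<close>. It follows from
  writing \<kappa> as the inner product of the second derivative of \<gamma> with \<open>N\<close>;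
  the projection disappears since \<open>N\<close> is orthogonal to \<gamma>.\<close>

lemma smooth_along_curvature:
  assumes I: "\<And>t. t \<in> I \<Longrightarrow> at t within I \<noteq> bot"
    and "smooth_along I \<gamma>" and F: "frenet_frame I \<gamma> T N \<kappa>"
  shows "smooth_along I \<kappa>"
proof (rule smooth_along_cong)
  show "smooth_along I (\<lambda>t. nderiv I 2 \<gamma> t \<bullet> N t)"
    using assms by (intro smooth_along_inner smooth_along_nderiv) (auto simp: frenet_frame_def)
  fix t assume t: "t \<in> I"
  have "vector_derivative T (at t within I) = nderiv I 2 \<gamma> t"
    unfolding numeral_2_eq_2 nderiv_Suc[of I "Suc 0"]
    using F t by (intro vector_derivative_within_cong) (auto simp: frenet_frame_def)
  then have "\<kappa> t *\<^sub>R N t = tproj (\<gamma> t) (nderiv I 2 \<gamma> t)"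
    using F t by (auto simp: frenet_frame_def covD_def)
  then have "(\<kappa> t *\<^sub>R N t) \<bullet> N t = tproj (\<gamma> t) (nderiv I 2 \<gamma> t) \<bullet> N t" by simp
  then show "\<kappa> t = nderiv I 2 \<gamma> t \<bullet> N t"
    using F t by (auto simp: frenet_frame_def tproj_def inner_simps inner_commute norm_eq_1)
qed

text \<open>The tension field is \<kappa> times \<open>N\<close>; four applications of
  \<open>covD_frenet\<close> then give the iterated Laplacian.\<close>

lemma k_tension_3_frenet:
  fixes \<kappa> :: "real \<Rightarrow> real"
  assumes I: "\<And>t. t \<in> I \<Longrightarrow> at t within I \<noteq> bot"
    and us: "unit_speed_curve I \<gamma>" and F: "frenet_frame I \<gamma> T N \<kappa>"
    and t: "t \<in> I"
  defines "k \<equiv> \<lambda>n. nderiv I n \<kappa>"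
  shows "k_tension 3 I \<gamma> t =
    (-5 * (\<kappa> t * k 3 t - 2 * (\<kappa> t)^3 * k 1 t + 2 * k 1 t * k 2 t)) *\<^sub>R T t +
    (k 4 t - 15 * \<kappa> t * (k 1 t)\<^sup>2 - 10 * (\<kappa> t)\<^sup>2 * k 2 t + (\<kappa> t)^5 + k 2 t - (\<kappa> t)^3) *\<^sub>R N t"
proof -
  have sm: "smooth_along I \<gamma>" using us by (simp add: unit_speed_curve_def)
  have smk: "smooth_along I \<kappa>" by (rule smooth_along_curvature[OF I sm F])
  have D: "(k n has_real_derivative k (Suc n) t) (at t within I)" if "t \<in> I" for n t
    using smooth_along_has_vector_derivative[OF smk that, of n]
    by (simp add: k_def has_real_derivative_iff_has_vector_derivative)
  have k0: "k 0 = \<kappa>" by (simp add: k_def)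
  have D0: "(\<kappa> has_real_derivative k 1 t) (at t within I)" if "t \<in> I" for t
    using D[OF that, of 0] k0 by simp
  have D1: "(k 1 has_real_derivative k 2 t) (at t within I)" if "t \<in> I" for t
    using D[OF that, of 1] by (simp add: numeral_2_eq_2)
  have D2: "(k 2 has_real_derivative k 3 t) (at t within I)" if "t \<in> I" for t
    using D[OF that, of 2] by simp
  have D3: "(k 3 has_real_derivative k 4 t) (at t within I)" if "t \<in> I" for t
    using D[OF that, of 3] by simp
  note DD = D0 D1 D1[unfolded One_nat_def] D2 D3
  \<comment> \<open>The new coefficients are separate variables \<open>u\<close> and
    \<open>v\<close>, so that each later step may state them in collected form.\<close>
  have cf: "covD I \<gamma> V s = u *\<^sub>R T s + v *\<^sub>R N s"
    if "\<And>r. r \<in> I \<Longrightarrow> V r = a r *\<^sub>R T r + b r *\<^sub>R N r"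
      and "(a has_real_derivative a') (at s within I)" "(b has_real_derivative b') (at s within I)"
      and "u = a' - b s * \<kappa> s" "v = b' + a s * \<kappa> s" "s \<in> I" for V a b a' b' u v s
    using covD_frenet[OF I sm F that(1,2,3,6)] that(4,5) by simp
  let ?\<tau> = "tension I \<gamma>" and ?L = "rough_laplacian I \<gamma>"
  have \<tau>0: "?\<tau> s = 0 *\<^sub>R T s + \<kappa> s *\<^sub>R N s" if "s \<in> I" for s
    using covD_cong[of I T "velocity I \<gamma>" s \<gamma>] F that by (auto simp: tension_def frenet_frame_def)
  have \<tau>1: "covD I \<gamma> ?\<tau> s = (- ((\<kappa> s)^2)) *\<^sub>R T s + k 1 s *\<^sub>R N s" if "s \<in> I" for s
    by (rule cf[OF \<tau>0 DERIV_const D0[OF that] _ _ that]) (auto simp: power2_eq_square)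
  have \<tau>2: "covD I \<gamma> (covD I \<gamma> ?\<tau>) s
      = (- 3 * \<kappa> s * k 1 s) *\<^sub>R T s + (k 2 s - (\<kappa> s)^3) *\<^sub>R N s" if "s \<in> I" for s
    by (rule cf[OF \<tau>1 _ D1[OF that] _ _ that, where a' = "- 2 * \<kappa> s * k 1 s"])
      (auto intro!: derivative_eq_intros DD that simp: power2_eq_square power3_eq_cube algebra_simps)
  have L1: "?L ?\<tau> s = (3 * \<kappa> s * k 1 s) *\<^sub>R T s + ((\<kappa> s)^3 - k 2 s) *\<^sub>R N s" if "s \<in> I" for s
    using \<tau>2[OF that] by (simp add: rough_laplacian_def algebra_simps)
  have L2: "covD I \<gamma> (?L ?\<tau>) s = (3 * (k 1 s)^2 + 4 * \<kappa> s * k 2 s - (\<kappa> s)^4) *\<^sub>R T s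
      + (6 * (\<kappa> s)^2 * k 1 s - k 3 s) *\<^sub>R N s" if "s \<in> I" for s
    by (rule cf[OF L1 _ _ _ _ that, where a' = "3 * (k 1 s)^2 + 3 * \<kappa> s * k 2 s"
          and b' = "3 * (\<kappa> s)^2 * k 1 s - k 3 s"])
      (auto intro!: derivative_eq_intros DD that
        simp: algebra_simps power2_eq_square power_numeral_reduce)
  have L3: "covD I \<gamma> (covD I \<gamma> (?L ?\<tau>)) t =
      (5 * (\<kappa> t * k 3 t - 2 * (\<kappa> t)^3 * k 1 t + 2 * k 1 t * k 2 t)) *\<^sub>R T t +
      (- (k 4 t - 15 * \<kappa> t * (k 1 t)\<^sup>2 - 10 * (\<kappa> t)\<^sup>2 * k 2 t + (\<kappa> t)^5)) *\<^sub>R N t"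
    by (rule cf[OF L2 _ _ _ _ t,
          where a' = "10 * k 1 t * k 2 t + 4 * \<kappa> t * k 3 t - 4 * (\<kappa> t)^3 * k 1 t"
          and b' = "12 * \<kappa> t * (k 1 t)^2 + 6 * (\<kappa> t)^2 * k 2 t - k 4 t"])
      (auto intro!: derivative_eq_intros DD t
        simp: algebra_simps power2_eq_square power_numeral_reduce)
  have fr: "norm (\<gamma> t) = 1" "T t \<bullet> \<gamma> t = 0" "N t \<bullet> \<gamma> t = 0" "velocity I \<gamma> t = T t"
    "T t \<bullet> T t = 1" "N t \<bullet> T t = 0"
    using F us t by (auto simp: frenet_frame_def unit_speed_curve_def norm_eq_1 inner_commute)
  \<comment> \<open>With both other arguments equal to the unit tangent, the curvature operator
    keeps exactly the normal part of the field.\<close>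
  have "curv (\<gamma> t) (?L ?\<tau> t) (velocity I \<gamma> t) (velocity I \<gamma> t) = ((\<kappa> t)^3 - k 2 t) *\<^sub>R N t"
    unfolding fr(4) by (subst curv_tangent) (simp_all add: fr(1-3,5,6) L1[OF t] inner_simps)
  moreover have "(?L ^^ 2) ?\<tau> t = - covD I \<gamma> (covD I \<gamma> (?L ?\<tau>)) t"
    by (simp add: numeral_2_eq_2 rough_laplacian_def)
  ultimately show ?thesis
    unfolding k_tension_def by (simp add: L3 algebra_simps)
qed

section \<open>Equivalence of 3-harmonicity and the stated system\<close>

theorem proposition7p4:
  fixes I :: "real set" and \<gamma> T N :: "real \<Rightarrow> real^3" and \<kappa> :: "real \<Rightarrow> real"
  assumes "is_interval I" and "interior I \<noteq> {}"
    and "unit_speed_curve I \<gamma>"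
    and "frenet_frame I \<gamma> T N \<kappa>"
  shows "k_harmonic 3 I \<gamma> \<longleftrightarrow>
    (\<forall>t\<in>I.
      nderiv I 4 \<kappa> t - 12 * (nderiv I 1 \<kappa> t)\<^sup>2 - 10 * (\<kappa> t)\<^sup>2 * nderiv I 2 \<kappa> t + (\<kappa> t) ^ 5
        - 3 * \<kappa> t * (nderiv I 1 \<kappa> t)\<^sup>2 + nderiv I 2 \<kappa> t - (\<kappa> t) ^ 3 = 0 \<and>
      \<kappa> t * nderiv I 3 \<kappa> t - 2 * (\<kappa> t) ^ 3 * nderiv I 1 \<kappa> t
        + 2 * nderiv I 1 \<kappa> t * nderiv I 2 \<kappa> t = 0)"
proof -
  define k where "k = (\<lambda>n. nderiv I n \<kappa>)"
  \<comment> \<open>One family contains both systems: \<open>sys 0 15\<close> expresses the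
    vanishing of the 3-tension, \<open>sys 12 3\<close> is the system of the theorem.\<close>
  define sys where "sys \<alpha> \<beta> \<longleftrightarrow> (\<forall>t\<in>I.
    k 4 t - (\<alpha> + \<beta> * \<kappa> t) * (k 1 t)\<^sup>2 - 10 * (\<kappa> t)\<^sup>2 * k 2 t + (\<kappa> t)^5 + k 2 t - (\<kappa> t)^3 = 0 \<and>
    \<kappa> t * k 3 t - 2 * (\<kappa> t)^3 * k 1 t + 2 * k 1 t * k 2 t = 0)" for \<alpha> \<beta>
  have I: "at t within I \<noteq> bot" if "t \<in> I" for t
    using at_within_interval_neq_bot assms(1,2) that by blast
  have sm: "smooth_along I \<kappa>"
    using smooth_along_curvature[OF I _ assms(4)] assms(3) by (simp add: unit_speed_curve_def)
  have D: "(k n has_real_derivative k (Suc n) t) (at t within I)" if "t \<in> I" for n t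
    using smooth_along_has_vector_derivative[OF sm that, of n]
    by (simp add: k_def has_real_derivative_iff_has_vector_derivative)
  have const: "k 1 t = 0" if "sys \<alpha> \<beta>" "\<beta> \<noteq> - 51/5" "t \<in> I" for \<alpha> \<beta> t
  proof (rule curvature_system_imp_constant[OF assms(1) I, where k = \<kappa> and ?k1.0 = "k 1"
        and ?k2.0 = "k 2" and ?k3.0 = "k 3" and ?k4.0 = "k 4" and \<alpha> = \<alpha> and \<beta> = \<beta>])
    show "(\<kappa> has_real_derivative k 1 t) (at t within I)" if "t \<in> I" for t
      using D[OF that, of 0] by (simp add: k_def)
    show "(k 1 has_real_derivative k 2 t) (at t within I)" if "t \<in> I" for t
      using D[OF that, of 1] by (simp add: numeral_2_eq_2)
    show "(k 2 has_real_derivative k 3 t) (at t within I)" if "t \<in> I" for t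
      using D[OF that, of 2] by simp
    show "(k 3 has_real_derivative k 4 t) (at t within I)" if "t \<in> I" for t
      using D[OF that, of 3] by simp
  qed (use that in \<open>auto simp: sys_def\<close>)
  have "k_harmonic 3 I \<gamma> \<longleftrightarrow> sys 0 15"
  proof -
    have "k_tension 3 I \<gamma> t = 0 \<longleftrightarrow>
        k 4 t - 15 * \<kappa> t * (k 1 t)\<^sup>2 - 10 * (\<kappa> t)\<^sup>2 * k 2 t + (\<kappa> t)^5 + k 2 t - (\<kappa> t)^3 = 0 \<and>
        \<kappa> t * k 3 t - 2 * (\<kappa> t)^3 * k 1 t + 2 * k 1 t * k 2 t = 0"
      (is "_ \<longleftrightarrow> ?A = 0 \<and> ?B = 0") if t: "t \<in> I" for t
    proof -
      have on: "T t \<bullet> T t = 1" "N t \<bullet> N t = 1" "T t \<bullet> N t = 0"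
        using assms(4) t by (auto simp: frenet_frame_def norm_eq_1)
      \<comment> \<open>Orthonormality lets the tangential and normal components be compared
        separately.\<close>
      have "x *\<^sub>R T t + y *\<^sub>R N t = 0 \<longleftrightarrow> x = 0 \<and> y = 0" for x y
      proof
        assume "x *\<^sub>R T t + y *\<^sub>R N t = 0"
        then have "(x *\<^sub>R T t + y *\<^sub>R N t) \<bullet> T t = 0" "(x *\<^sub>R T t + y *\<^sub>R N t) \<bullet> N t = 0"
          by simp_all
        then show "x = 0 \<and> y = 0" using on by (simp add: inner_simps inner_commute)
      qed simp
      moreover have "k_tension 3 I \<gamma> t = (-5 * ?B) *\<^sub>R T t + ?A *\<^sub>R N t"
        unfolding k_def by (rule k_tension_3_frenet[OF I assms(3,4) t])
      ultimately have "k_tension 3 I \<gamma> t = 0 \<longleftrightarrow> -5 * ?B = 0 \<and> ?A = 0"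
        by (simp only:)
      then show ?thesis by (simp only: mult_eq_0_iff) auto
    qed
    then show ?thesis by (simp add: k_harmonic_def sys_def)
  qed
  also have "\<dots> \<longleftrightarrow> sys 12 3"
  \<comment> \<open>Neither 15 nor 3 equals -51/5, so \<open>const\<close> applies in both
    directions. Once the derivative of \<kappa> vanishes, the term carrying \<alpha> and \<beta> is
    0 and the systems coincide.\<close>
  proof
    assume *: "sys 0 15"
    then have "\<forall>t\<in>I. k 1 t = 0" using const by simp
    with * show "sys 12 3" by (simp add: sys_def)
  next
    assume *: "sys 12 3"
    then have "\<forall>t\<in>I. k 1 t = 0" using const by simp
    with * show "sys 0 15" by (simp add: sys_def)
  qed
  finally show ?thesis by (simp add: sys_def k_def algebra_simps)
qed

end
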